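(* Let $\gamma$ be a smooth closed nondegenerate curve in the equi-affine plane, parametrised by equi-affine arc-length, with equi-affine curvature $\kappa$. Then $\gamma$ is a critical point of $\int\kappa\,\mathrm{d}s$ with respect to deformations under which the total equi-affine arc-length is preserved if and only if $\gamma$ is an ellipse.
   Context: The equi-affine plane is $\mathbb{R}^2$ with area form $|u,v|=\det(u,v)$. The curve satisfies $|\gamma',\gamma''|=1$; primes denote $s$-derivatives; $\kappa$ is defined by $\gamma'''=-\kappa\gamma'$. Being a critical point of $\int\kappa\,\mathrm{d}s$ with respect to deformations preserving the total equi-affine arc-length $L=\int\mathrm{d}s$ means (Lagrange multiplier formulation) that there is a constant $\mu$ with $\delta\int\kappa\,\mathrm{d}s=\mu\,\delta L$ for all smooth variations of the closed curve. *)

theory Defs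
  imports "HOL-Analysis.Analysis"
begin

definition det2 :: "real \<times> real \<Rightarrow> real \<times> real \<Rightarrow> real" where
  "det2 u v = fst u * snd v - snd u * fst v"

definition vd :: "(real \<Rightarrow> 'a::real_normed_vector) \<Rightarrow> real \<Rightarrow> 'a" where
  "vd c = (\<lambda>t. vector_derivative c (at t))"

definition smooth_curve :: "(real \<Rightarrow> 'a::real_normed_vector) \<Rightarrow> bool" where
  "smooth_curve c \<longleftrightarrow> (\<exists>D :: nat \<Rightarrow> real \<Rightarrow> 'a. D 0 = c \<and>
      (\<forall>n t. (D n has_vector_derivative D (Suc n) t) (at t)))"

definition smooth2 :: "(real \<Rightarrow> real \<Rightarrow> 'a::real_normed_vector) \<Rightarrow> bool" where
  "smooth2 G \<longleftrightarrow> (\<exists>D :: nat \<Rightarrow> nat \<Rightarrow> real \<Rightarrow> real \<Rightarrow> 'a. D 0 0 = G \<and>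
      (\<forall>i j. continuous_on UNIV (\<lambda>p. D i j (fst p) (snd p)) \<and>
        (\<forall>e t. ((\<lambda>e'. D i j e' t) has_vector_derivative D (Suc i) j e t) (at e) \<and>
               ((\<lambda>t'. D i j e t') has_vector_derivative D i (Suc j) e t) (at t))))"

text \<open>Equi-affine arc-length speed ds/dt = |c',c''|^(1/3) of an arbitrarily
  parametrised (nondegenerate, positively oriented) curve.\<close>
definition aff_speed :: "(real \<Rightarrow> real \<times> real) \<Rightarrow> real \<Rightarrow> real" where
  "aff_speed c t = det2 (vd c t) (vd (vd c) t) powr (1/3)"

text \<open>Equi-affine curvature of an arbitrarily parametrised curve.  With u = ds/dt this is
  kappa = |c'',c'''|/u^5 + u''/u^3 - 3 u'^2/u^4; for an arc-length parametrised curve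
  (u = 1) it is |c'',c'''|, i.e. the kappa with c''' = - kappa c'.\<close>
definition aff_curv :: "(real \<Rightarrow> real \<times> real) \<Rightarrow> real \<Rightarrow> real" where
  "aff_curv c t =
     (let u = aff_speed c in
      det2 (vd (vd c) t) (vd (vd (vd c)) t) / u t ^ 5
      + vd (vd u) t / u t ^ 3 - 3 * (vd u t)\<^sup>2 / u t ^ 4)"

definition aff_length :: "(real \<Rightarrow> real \<times> real) \<Rightarrow> real \<Rightarrow> real" where
  "aff_length c L = integral {0..L} (aff_speed c)"

definition aff_total_curv :: "(real \<Rightarrow> real \<times> real) \<Rightarrow> real \<Rightarrow> real" where
  "aff_total_curv c L = integral {0..L} (\<lambda>t. aff_curv c t * aff_speed c t)"

definition admissible_variation ::
    "(real \<Rightarrow> real \<times> real) \<Rightarrow> real \<Rightarrow> (real \<Rightarrow> real \<Rightarrow> real \<times> real) \<Rightarrow> bool" where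
  "admissible_variation \<gamma> L G \<longleftrightarrow>
     smooth2 G \<and> G 0 = \<gamma> \<and> (\<forall>e t. G e (t + L) = G e t)"

text \<open>Critical point of total curvature under length-preserving deformations
  (Lagrange multiplier formulation): delta(int kappa ds) = mu * delta L for all variations.\<close>
definition length_constrained_critical :: "(real \<Rightarrow> real \<times> real) \<Rightarrow> real \<Rightarrow> bool" where
  "length_constrained_critical \<gamma> L \<longleftrightarrow>
     (\<exists>\<mu>::real. \<forall>G. admissible_variation \<gamma> L G \<longrightarrow>
        ((\<lambda>e. aff_total_curv (G e) L - \<mu> * aff_length (G e) L) has_real_derivative 0) (at 0))"

definition is_ellipse :: "(real \<times> real) set \<Rightarrow> bool" where
  "is_ellipse E \<longleftrightarrow> (\<exists>c1 c2 a b d e. a * e - b * d \<noteq> 0 \<and>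
      E = {(c1 + a * cos \<theta> + b * sin \<theta>, c2 + d * cos \<theta> + e * sin \<theta>) | \<theta>. True})"

end

(* For an arc-length parametrised closed curve the first variation of the total curvature minus mu
   times the length, in the direction V, is 2/3 times the integral of
   (kappa'' + kappa^2 + mu kappa) |gamma', V|.  Testing with a multiple of gamma'' gives the
   Euler-Lagrange equation w'' = - kappa w for w = kappa + mu.  Since gamma' solves the same equation,
   w = |gamma', v| for a constant vector v, so w has mean zero because the curve closes up;
   integrating w^2 = mu w - w'' over a period gives w = 0.  So kappa is constant, and it is positive
   because the curve is closed, which leaves ellipses only.  Conversely, an ellipse has constant
   kappa and satisfies the Euler-Lagrange equation with mu = - kappa. *)
theory Submission
  imports Defs
begin

section \<open>The area form as a bilinear map\<close>

lemma bounded_bilinear_det2: "bounded_bilinear det2"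
proof
  fix a a' b b' :: "real \<times> real" and r :: real
  show "det2 (a + a') b = det2 a b + det2 a' b" "det2 a (b + b') = det2 a b + det2 a b'"
    "det2 (r *\<^sub>R a) b = r *\<^sub>R det2 a b" "det2 a (r *\<^sub>R b) = r *\<^sub>R det2 a b"
    by (simp_all add: det2_def algebra_simps)
  show "\<exists>K. \<forall>a b. norm (det2 a b) \<le> norm a * norm b * K"
  proof (intro exI allI)
    fix a b :: "real \<times> real"
    have *: "\<bar>fst c\<bar> \<le> norm c" "\<bar>snd c\<bar> \<le> norm c" for c :: "real \<times> real"
      using norm_fst_le[of "fst c" "snd c"] norm_snd_le[of "snd c" "fst c"] by auto
    have "\<bar>fst a * snd b\<bar> \<le> norm a * norm b" "\<bar>snd a * fst b\<bar> \<le> norm a * norm b"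
      by (auto simp: abs_mult intro!: mult_mono *)
    then show "norm (det2 a b) \<le> norm a * norm b * 2"
      by (auto simp: det2_def)
  qed
qed

lemmas continuous_on_det2 [continuous_intros] =
  bounded_bilinear.continuous_on[OF bounded_bilinear_det2]

lemma has_real_derivative_det2 [derivative_intros]:
  assumes "(f has_vector_derivative f') (at x)" "(g has_vector_derivative g') (at x)"
  shows "((\<lambda>x. det2 (f x) (g x)) has_real_derivative det2 f' (g x) + det2 (f x) g') (at x)"
  using bounded_bilinear.has_vector_derivative[OF bounded_bilinear_det2 assms]
  by (simp add: has_real_derivative_iff_has_vector_derivative add.commute)

lemma vd_eqI:
  assumes "\<And>t. (c has_vector_derivative c' t) (at t)"
  shows "vd c = c'"
  using vector_derivative_at[OF assms] by (auto simp: vd_def)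

section \<open>Periodic functions\<close>

lemma has_vector_derivative_periodic:
  assumes "\<And>t. (f has_vector_derivative f' t) (at t)" and "\<And>t. f (t + L) = f t"
  shows "f' (t + L) = f' t"
proof -
  have "((\<lambda>t. f (t + L)) has_vector_derivative f' (t + L)) (at t)"
  proof -
    have "((\<lambda>t. t + L) has_vector_derivative 1) (at t)"
      by (auto intro!: derivative_eq_intros)
    from vector_diff_chain_at[OF this, of f "f' (t + L)"] assms(1) show ?thesis
      by (simp add: o_def)
  qed
  then show ?thesis
    using assms vector_derivative_unique_at by (metis (no_types, lifting) ext)
qed

text \<open>Subtracting \<open>\<lfloor>t / L\<rfloor>\<close> periods moves \<open>t\<close> into
  the fundamental interval. This carries facts known on the compact \<open>{0..L}\<close> to the
  whole line.\<close>

lemma periodic_representative: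
  fixes f :: "real \<Rightarrow> 'b" and L :: real
  assumes L: "L > 0" and per: "\<And>t. f (t + L) = f t"
  obtains s where "s \<in> {0..L}" "f s = f t"
proof -
  have nat: "f (t + real n * L) = f t" for n t
    using per[of "t + real k * L" for k] by (induction n) (auto simp: algebra_simps)
  have int: "f (t + of_int n * L) = f t" for n t
    using nat[of t "nat n"] nat[of "t + of_int n * L" "nat (- n)"] by (cases "n \<ge> 0") auto
  define n where "n = \<lfloor>t / L\<rfloor>"
  have "of_int n \<le> t / L" "t / L \<le> of_int n + 1"
    unfolding n_def by linarith+
  then have "t + of_int (- n) * L \<in> {0..L}"
    using L by (simp add: field_simps)
  with int that show ?thesis by blast
qed

lemma periodic_square_integral_zero:
  fixes f :: "real \<Rightarrow> real"
  assumes L: "L > 0" and per: "\<And>t. f (t + L) = f t" and cont: "continuous_on UNIV f"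
    and int: "integral {0..L} (\<lambda>t. (f t)\<^sup>2) = 0"
  shows "f t = 0"
proof -
  have "continuous_on {0..L} (\<lambda>t. (f t)\<^sup>2)"
    using cont by (intro continuous_intros) (auto intro: continuous_on_subset)
  then have "\<forall>s\<in>{0..L}. (f s)\<^sup>2 = 0"
    using int L integral_eq_0_iff[of 0 L "\<lambda>t. (f t)\<^sup>2"] by auto
  moreover obtain s where "s \<in> {0..L}" "f s = f t"
    using periodic_representative[of L f t] L per by metis
  ultimately show ?thesis by force
qed

section \<open>Closure properties of smooth curves\<close>

text \<open>If every member of \<open>S\<close> has a derivative in \<open>S\<close>, choosing one
  and iterating the choice yields the whole sequence of derivatives, without a closed formula for
  the n-th one.\<close>

lemma smooth_curve_coinduct:
  assumes "c \<in> S"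
    and "\<And>f. f \<in> S \<Longrightarrow> \<exists>f'\<in>S. \<forall>t. (f has_vector_derivative f' t) (at t)"
  shows "smooth_curve c"
proof -
  obtain d where d: "\<And>f. f \<in> S \<Longrightarrow> d f \<in> S \<and> (\<forall>t. (f has_vector_derivative d f t) (at t))"
    using assms(2) by metis
  have "(d ^^ n) c \<in> S" for n
    using assms(1) d by (induction n) auto
  then show ?thesis
    unfolding smooth_curve_def using d by (intro exI[of _ "\<lambda>n. (d ^^ n) c"]) auto
qed

lemma smooth_curve_const: "smooth_curve (\<lambda>t. c)"
  by (rule smooth_curve_coinduct[of _ "range (\<lambda>c t. c)"]) (auto intro!: derivative_intros)

lemma smooth_curve_add:
  assumes "smooth_curve f" "smooth_curve g"
  shows "smooth_curve (\<lambda>t. f t + g t)"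
proof -
  obtain F G where "F 0 = f" "\<And>n t. (F n has_vector_derivative F (Suc n) t) (at t)"
    "G 0 = g" "\<And>n t. (G n has_vector_derivative G (Suc n) t) (at t)"
    using assms unfolding smooth_curve_def by metis
  then show ?thesis
    unfolding smooth_curve_def
    by (intro exI[of _ "\<lambda>n t. F n t + G n t"]) (auto intro!: derivative_intros)
qed

text \<open>By the product rule, finite sums of terms \<open>B (F i t) (G j t)\<close> have
  derivatives of the same kind. Lists of index pairs admit repetitions, which avoids the binomial
  coefficients of the Leibniz formula.\<close>

lemma smooth_curve_bilinear:
  assumes "bounded_bilinear B" and "smooth_curve f" "smooth_curve g"
  shows "smooth_curve (\<lambda>t. B (f t) (g t))"
proof -
  obtain F G where FG: "F 0 = f" "\<And>n t. (F n has_vector_derivative F (Suc n) t) (at t)"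
    "G 0 = g" "\<And>n t. (G n has_vector_derivative G (Suc n) t) (at t)"
    using assms unfolding smooth_curve_def by metis
  define S where "S = range (\<lambda>xs t. \<Sum>(i, j)\<leftarrow>xs. B (F i t) (G j t))"
  have sum: "(\<lambda>t. h t + h' t) \<in> S" if S: "h \<in> S" "h' \<in> S" for h h'
  proof -
    obtain xs ys where "h = (\<lambda>t. \<Sum>(i, j)\<leftarrow>xs. B (F i t) (G j t))"
      "h' = (\<lambda>t. \<Sum>(i, j)\<leftarrow>ys. B (F i t) (G j t))"
      using S by (auto simp: S_def)
    then show ?thesis
      unfolding S_def by (intro image_eqI[of _ _ "xs @ ys"]) auto
  qed
  have single: "(\<lambda>t. B (F i t) (G j t)) \<in> S" for i j
    unfolding S_def by (intro image_eqI[of _ _ "[(i, j)]"]) auto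
  have deriv: "\<exists>h\<in>S. \<forall>t. ((\<lambda>t. \<Sum>(i, j)\<leftarrow>xs. B (F i t) (G j t)) has_vector_derivative h t) (at t)"
    for xs
  proof (induction xs)
    case Nil
    have "(\<lambda>t. 0) \<in> S" unfolding S_def by (intro image_eqI[of _ _ "[]"]) auto
    then show ?case by (auto intro!: bexI derivative_intros)
  next
    case (Cons x xs)
    obtain i j where x: "x = (i, j)" by force
    obtain h where h: "h \<in> S"
      "\<And>t. ((\<lambda>t. \<Sum>(i, j)\<leftarrow>xs. B (F i t) (G j t)) has_vector_derivative h t) (at t)"
      using Cons by blast
    have "((\<lambda>t. \<Sum>(i, j)\<leftarrow>x # xs. B (F i t) (G j t)) has_vector_derivative
        B (F i t) (G (Suc j) t) + B (F (Suc i) t) (G j t) + h t) (at t)" for t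
      using bounded_bilinear.has_vector_derivative[OF assms(1) FG(2)[of i t] FG(4)[of j t]] h(2)[of t]
      by (auto simp: x intro!: derivative_intros)
    then show ?case
      by (intro bexI[OF _ sum[OF sum[OF single[of i "Suc j"] single[of "Suc i" j]] h(1)]] allI)
  qed
  show ?thesis
  proof (rule smooth_curve_coinduct)
    show "(\<lambda>t. B (f t) (g t)) \<in> S" using single[of 0 0] FG by simp
    show "\<exists>f'\<in>S. \<forall>t. (h has_vector_derivative f' t) (at t)" if "h \<in> S" for h
      using that deriv by (auto simp: S_def)
  qed
qed

section \<open>Length and curvature densities and their linearisation\<close>

text \<open>The density \<open>\<kappa> ds/dt\<close> as a function of the jet of the curve; \<open>|c', c'''|\<close> and
  \<open>|c'', c'''| + |c', c''''|\<close> are the first two derivatives of \<open>|c', c''|\<close>.\<close>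
definition curv_density ::
    "real \<times> real \<Rightarrow> real \<times> real \<Rightarrow> real \<times> real \<Rightarrow> real \<times> real \<Rightarrow> real" where
  "curv_density c1 c2 c3 c4 =
     det2 c1 c2 powr (- (4/3)) * ((4 * det2 c2 c3 + det2 c1 c4) / 3)
     - 5/9 * det2 c1 c2 powr (- (7/3)) * (det2 c1 c3)\<^sup>2"

text \<open>This trades the nested operators \<open>vd\<close> for closed expressions in the jet of
  the curve, which can then be differentiated in a deformation parameter. With \<open>W\<close> =
  \<open>|c', c''|\<close> the speed is the cube root of \<open>W\<close>, and \<open>W'\<close> =
  \<open>|c', c'''|\<close> because \<open>|c'', c''|\<close> vanishes.\<close>

lemma aff_densities:
  assumes d: "\<And>t. (c has_vector_derivative c1 t) (at t)" "\<And>t. (c1 has_vector_derivative c2 t) (at t)"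
    "\<And>t. (c2 has_vector_derivative c3 t) (at t)" "\<And>t. (c3 has_vector_derivative c4 t) (at t)"
    and pos: "\<And>t. det2 (c1 t) (c2 t) > 0"
  shows "aff_speed c t = det2 (c1 t) (c2 t) powr (1/3)"
    and "aff_curv c t * aff_speed c t = curv_density (c1 t) (c2 t) (c3 t) (c4 t)"
proof -
  have vd: "vd c = c1" "vd c1 = c2" "vd c2 = c3"
    using d by (auto intro!: vd_eqI)
  define W where "W t = det2 (c1 t) (c2 t)" for t
  define W1 where "W1 t = det2 (c1 t) (c3 t)" for t
  define W2 where "W2 t = det2 (c2 t) (c3 t) + det2 (c1 t) (c4 t)" for t
  have W [derivative_intros]: "(W has_real_derivative W1 t) (at t)" for t
    unfolding W_def W1_def by (auto intro!: derivative_eq_intros d) (simp add: det2_def)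
  have W1 [derivative_intros]: "(W1 has_real_derivative W2 t) (at t)" for t
    unfolding W1_def W2_def by (auto intro!: derivative_eq_intros d)
  have Wpos: "W t > 0" for t using pos by (simp add: W_def)
  have u: "aff_speed c = (\<lambda>t. W t powr (1/3))"
    by (auto simp: aff_speed_def vd W_def)
  then show "aff_speed c t = det2 (c1 t) (c2 t) powr (1/3)" by (simp add: W_def)
  define u1 where "u1 t = 1/3 * W t powr (- (2/3)) * W1 t" for t
  define u2 where "u2 t = 1/3 * W t powr (- (2/3)) * W2 t - 2/9 * W t powr (- (5/3)) * (W1 t)\<^sup>2" for t
  have "(aff_speed c has_real_derivative u1 t) (at t)" for t
    unfolding u u1_def using Wpos
    by (auto intro!: derivative_eq_intros DERIV_fun_powr)
  then have vu: "vd (aff_speed c) = u1"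
    by (intro vd_eqI) (simp add: has_real_derivative_iff_has_vector_derivative)
  have "(u1 has_real_derivative u2 t) (at t)" for t
    unfolding u1_def u2_def using Wpos[of t]
    by (auto intro!: derivative_eq_intros DERIV_fun_powr simp: power2_eq_square)
  then have vu1: "vd u1 = u2"
    by (intro vd_eqI) (simp add: has_real_derivative_iff_has_vector_derivative)
  have pw: "(W t powr (1/3)) ^ n = W t powr (n/3)" for n
    using Wpos[of t] by (simp add: powr_power)
  \<comment> \<open>All powers of \<open>W\<close> that occur are integer powers of its cube root
    \<open>z\<close>, so the claim becomes a rational identity.\<close>
  define z where "z = W t powr (1/3)"
  have z: "z > 0" using Wpos[of t] by (simp add: z_def)
  have neg: "W t powr (- (n/3)) = 1 / z ^ n" for n :: nat
    using pw[of n] by (simp add: z_def powr_minus_divide)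
  note neg2 = neg[of 2] neg[of 4] neg[of 5] neg[of 7]
  show "aff_curv c t * aff_speed c t = curv_density (c1 t) (c2 t) (c3 t) (c4 t)"
    unfolding aff_curv_def curv_density_def Let_def vu vu1 vd
    using z neg2
    by (simp add: u W_def[symmetric] W1_def[symmetric] z_def[symmetric] u1_def u2_def)
      (simp add: W2_def field_simps power2_eq_square power_numeral_reduce)
qed


text \<open>The differential of \<open>curv_density\<close> at the jet (c1, c2, c3, c4), applied to
  the direction (v1, v2, v3, v4).\<close>

definition curv_density' ::
    "real \<times> real \<Rightarrow> real \<times> real \<Rightarrow> real \<times> real \<Rightarrow> real \<times> real \<Rightarrow>
     real \<times> real \<Rightarrow> real \<times> real \<Rightarrow> real \<times> real \<Rightarrow> real \<times> real \<Rightarrow> real" where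
  "curv_density' c1 c2 c3 c4 v1 v2 v3 v4 =
     (let W = det2 c1 c2; dW = det2 v1 c2 + det2 c1 v2 in
       - (4/3) * W powr (- (7/3)) * dW * ((4 * det2 c2 c3 + det2 c1 c4) / 3)
       + W powr (- (4/3)) * ((4 * (det2 v2 c3 + det2 c2 v3) + det2 v1 c4 + det2 c1 v4) / 3)
       + 35/27 * W powr (- (10/3)) * dW * (det2 c1 c3)\<^sup>2
       - 10/9 * W powr (- (7/3)) * det2 c1 c3 * (det2 v1 c3 + det2 c1 v3))"

lemma has_real_derivative_curv_density:
  assumes "(c1 has_vector_derivative v1) (at e)" "(c2 has_vector_derivative v2) (at e)"
    "(c3 has_vector_derivative v3) (at e)" "(c4 has_vector_derivative v4) (at e)"
    and "det2 (c1 e) (c2 e) > 0"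
  shows "((\<lambda>e. curv_density (c1 e) (c2 e) (c3 e) (c4 e)) has_real_derivative
           curv_density' (c1 e) (c2 e) (c3 e) (c4 e) v1 v2 v3 v4) (at e)"
  unfolding curv_density_def curv_density'_def Let_def
  by (rule derivative_eq_intros DERIV_fun_powr assms refl | simp)+
     (simp add: algebra_simps power2_eq_square add_divide_distrib diff_divide_distrib)

lemma has_real_derivative_speed:
  assumes "(c1 has_vector_derivative v1) (at e)" "(c2 has_vector_derivative v2) (at e)"
    and "det2 (c1 e) (c2 e) > 0"
  shows "((\<lambda>e. det2 (c1 e) (c2 e) powr (1/3)) has_real_derivative
           1/3 * det2 (c1 e) (c2 e) powr (- (2/3)) * (det2 v1 (c2 e) + det2 (c1 e) v2)) (at e)"
  by (rule derivative_eq_intros DERIV_fun_powr assms refl | simp)+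

section \<open>Closed curves parametrised by arc-length\<close>

locale affine_arclength_curve =
  fixes g :: "nat \<Rightarrow> real \<Rightarrow> real \<times> real" and \<kappa> :: "real \<Rightarrow> real" and L :: real
  assumes g [derivative_intros]: "\<And>n t. (g n has_vector_derivative g (Suc n) t) (at t)"
    and L: "L > 0"
    and g_per: "\<And>t. g 0 (t + L) = g 0 t"
    and arclength: "\<And>t. det2 (g 1 t) (g 2 t) = 1"
    and g3: "\<And>t. g 3 t = - (\<kappa> t *\<^sub>R g 1 t)"
begin

text \<open>The first derivative of \<open>\<kappa>\<close> = \<open>|g 2, g 3|\<close>, where the
  term \<open>|g 3, g 3|\<close> drops out; \<open>\<kappa>2\<close> below is the second. Writing
  them as determinants lets them inherit continuity and periodicity from the curve.\<close>

definition \<kappa>1 :: "real \<Rightarrow> real" where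
  "\<kappa>1 t = det2 (g 2 t) (g 4 t)"

definition \<kappa>2 :: "real \<Rightarrow> real" where
  "\<kappa>2 t = det2 (g 3 t) (g 4 t) + det2 (g 2 t) (g 5 t)"

definition EL :: "real \<Rightarrow> real \<Rightarrow> real" where
  "EL \<mu> t = \<kappa>2 t + (\<kappa> t)\<^sup>2 + \<mu> * \<kappa> t"

lemma g_deriv [derivative_intros]:
  "(g 0 has_vector_derivative g 1 t) (at t)" "(g 1 has_vector_derivative g 2 t) (at t)"
  "(g 2 has_vector_derivative g 3 t) (at t)" "(g 3 has_vector_derivative g 4 t) (at t)"
  "(g 4 has_vector_derivative g 5 t) (at t)" "(g (Suc 0) has_vector_derivative g 2 t) (at t)"
  using g[of 0 t] g[of 1 t] g[of 2 t] g[of 3 t] g[of 4 t] by (simp_all add: numeral_eq_Suc)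

lemma periodic_g: "g n (t + L) = g n t"
proof (induction n arbitrary: t)
  case (Suc n)
  show ?case using Suc has_vector_derivative_periodic[OF g] by blast
qed (rule g_per)

text \<open>Pairing the defining relation \<open>g3\<close> with \<open>g 2\<close> isolates
  \<open>\<kappa>\<close>. The locale assumes no regularity of \<open>\<kappa>\<close>; it all comes
  from this formula.\<close>

lemma \<kappa>_eq: "\<kappa> t = det2 (g 2 t) (g 3 t)"
  using arclength[of t] unfolding g3 det2_def by (simp add: algebra_simps)

lemma \<kappa>_deriv [derivative_intros]: "(\<kappa> has_real_derivative \<kappa>1 t) (at t)"
proof -
  have "\<kappa> = (\<lambda>t. det2 (g 2 t) (g 3 t))" using \<kappa>_eq by auto
  then show ?thesis
    by (auto intro!: derivative_eq_intros simp: \<kappa>1_def) (simp add: det2_def)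
qed

lemma \<kappa>1_deriv [derivative_intros]: "(\<kappa>1 has_real_derivative \<kappa>2 t) (at t)"
  unfolding \<kappa>1_def[abs_def] \<kappa>2_def by (auto intro!: derivative_eq_intros)

lemma periodic_\<kappa>: "\<kappa> (t + L) = \<kappa> t" "\<kappa>1 (t + L) = \<kappa>1 t" "EL \<mu> (t + L) = EL \<mu> t"
  by (simp_all add: \<kappa>_eq \<kappa>1_def \<kappa>2_def EL_def periodic_g)

lemma g4: "g 4 t = - (\<kappa>1 t *\<^sub>R g 1 t) - \<kappa> t *\<^sub>R g 2 t"
proof -
  have "(g 3 has_vector_derivative - (\<kappa>1 t *\<^sub>R g 1 t) - \<kappa> t *\<^sub>R g 2 t) (at t)"
    unfolding g3[abs_def] by (auto intro!: derivative_eq_intros)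
  then show ?thesis
    using g_deriv(4) vector_derivative_unique_at by blast
qed

lemma continuous_on_g [continuous_intros]: "continuous_on A (g n)"
  using g by (meson continuous_at_imp_continuous_on has_vector_derivative_continuous)

lemma continuous_on_EL: "continuous_on A (EL \<mu>)"
  unfolding EL_def[abs_def] \<kappa>2_def \<kappa>_eq by (intro continuous_intros)

lemma smooth_g: "smooth_curve (g n)"
  unfolding smooth_curve_def by (rule exI[of _ "\<lambda>m. g (m + n)"]) (auto intro: g)

lemma smooth_EL: "smooth_curve (EL \<mu>)"
  unfolding EL_def[abs_def] \<kappa>2_def \<kappa>_eq power2_eq_square
  by (intro smooth_curve_add smooth_curve_bilinear[OF bounded_bilinear_det2]
      smooth_curve_bilinear[OF bounded_bilinear_mult] smooth_g smooth_curve_const)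

section \<open>The first variation\<close>

text \<open>Up to the derivative of a periodic function, the first variation of the integrand
  only sees the component \<open>|\<gamma>', V|\<close> of the variation field, as it must because the functional
  does not depend on the parametrisation.\<close>
lemma first_variation_integral:
  assumes V: "\<And>n t. (V n has_vector_derivative V (Suc n) t) (at t)"
    and V_per: "\<And>n t. V n (t + L) = V n t"
  shows "integral {0..L} (\<lambda>t. curv_density' (g 1 t) (g 2 t) (g 3 t) (g 4 t) (V 1 t) (V 2 t) (V 3 t) (V 4 t)
            - \<mu> * (1/3 * (det2 (V 1 t) (g 2 t) + det2 (g 1 t) (V 2 t))))
         = integral {0..L} (\<lambda>t. 2/3 * EL \<mu> t * det2 (g 1 t) (V 0 t))"
    (is "integral _ ?I = integral _ ?J")
proof -
  define b where "b i j t = det2 (g i t) (V j t)" for i j t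
  have b: "(b i j has_real_derivative b (Suc i) j t + b i (Suc j) t) (at t)" for i j t
    using has_real_derivative_det2[OF g V] by (simp add: b_def[abs_def])
  have b_swap: "det2 (V j t) (g i t) = - b i j t" for i j t
    by (simp add: b_def det2_def)
  \<comment> \<open>\<open>H\<close> collects the boundary terms left by integrating by parts until
    the variation field enters only through \<open>b 1 0\<close>. It is periodic, so its derivative
    integrates to zero.\<close>
  define H where "H t = b 2 2 t + 2/3 * (\<kappa> t * (b 2 0 t + b 1 1 t) - \<kappa>1 t * b 1 0 t)
      - \<mu>/3 * (b 1 1 t - 2 * b 2 0 t) + 1/3 * (b 1 3 t - b 3 1 t)" for t
  define H' where "H' t = b 3 2 t + b 2 3 t
      + 2/3 * (\<kappa> t * (b 3 0 t + 2 * b 2 1 t + b 1 2 t) - \<kappa>2 t * b 1 0 t)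
      - \<mu>/3 * (b 1 2 t - b 2 1 t - 2 * b 3 0 t)
      + 1/3 * (b 2 3 t + b 1 4 t - b 4 1 t - b 3 2 t)" for t
  have "(H has_real_derivative H' t) (at t)" for t
    unfolding H_def H'_def
    by (rule derivative_eq_intros b \<kappa>_deriv \<kappa>1_deriv refl)+
      (simp add: eval_nat_numeral algebra_simps)
  then have "(H' has_integral H L - H 0) {0..L}"
    using L by (intro fundamental_theorem_of_calculus)
      (auto simp: has_real_derivative_iff_has_vector_derivative[symmetric]
        intro: has_field_derivative_at_within)
  moreover have "H L = H 0"
    using periodic_g[of _ 0] V_per[of _ 0] periodic_\<kappa>[of 0] by (simp add: H_def b_def)
  ultimately have H': "(H' has_integral 0) {0..L}" by simp
  have IJ: "?I t = ?J t + H' t" for t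
  proof -
    have 1: "det2 (g 2 t) (g 3 t) = \<kappa> t" "det2 (g 1 t) (g 2 t) = 1" "det2 (g 1 t) (g 3 t) = 0"
      using \<kappa>_eq arclength by (auto simp: g3 det2_def)
    have 2: "det2 (g 1 t) (g 4 t) = - \<kappa> t"
      using arclength[of t] by (simp add: g4 det2_def algebra_simps) 
    \<comment> \<open>The structure equations \<open>g3\<close> and \<open>g4\<close> eliminate
      \<open>b 3 j\<close> and \<open>b 4 j\<close>, so that both sides of \<open>IJ\<close> can be
      compared in terms of \<open>b 1 j\<close> and \<open>b 2 j\<close>.\<close>
    have 3: "b 3 j t = - \<kappa> t * b 1 j t" "b 4 j t = - \<kappa>1 t * b 1 j t - \<kappa> t * b 2 j t" for j
      by (simp_all add: b_def g3 g4 det2_def algebra_simps)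
    show ?thesis
      unfolding H'_def EL_def curv_density'_def Let_def b_swap 1 2 unfolding b_def[symmetric] 3
      by simp (simp add: field_simps power2_eq_square)
  qed
  have cV: "continuous_on A (V n)" for A n
    using V by (meson continuous_at_imp_continuous_on has_vector_derivative_continuous)
  have "?J integrable_on {0..L}"
    by (intro integrable_continuous_interval continuous_intros continuous_on_EL cV)
  then show ?thesis
    unfolding IJ using H' by (subst integral_add) (auto simp: has_integral_iff)
qed

text \<open>For small \<open>e\<close> the functional is the integral of a density that is
  continuously differentiable in \<open>e\<close>, so it may be differentiated under the integral
  sign; at \<open>e = 0\<close> the previous lemma applies. The first property of \<open>V\<close>
  pins it down as the velocity of the deformation.\<close>

lemma first_variation:
  assumes G: "admissible_variation (g 0) L G"
  obtains V where "\<And>e t. ((\<lambda>e. G e t) has_vector_derivative V e t) (at e)"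
    "((\<lambda>e. aff_total_curv (G e) L - \<mu> * aff_length (G e) L) has_real_derivative
       integral {0..L} (\<lambda>t. 2/3 * EL \<mu> t * det2 (g 1 t) (V 0 t))) (at 0)"
proof -
  obtain D where D00: "D 0 0 = G" and D: "\<forall>i j. continuous_on UNIV (\<lambda>p. D i j (fst p) (snd p)) \<and>
      (\<forall>e t. ((\<lambda>e'. D i j e' t) has_vector_derivative D (Suc i) j e t) (at e) \<and>
             ((\<lambda>t'. D i j e t') has_vector_derivative D i (Suc j) e t) (at t))"
    using G unfolding admissible_variation_def smooth2_def by (elim conjE exE)
  have cont: "continuous_on UNIV (\<lambda>p. D i j (fst p) (snd p))"
    and De: "((\<lambda>e. D i j e t) has_vector_derivative D (Suc i) j e t) (at e)"
    and Dt: "(D i j e has_vector_derivative D i (Suc j) e t) (at t)" for i j e t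
    using D by blast+
  have D_per: "D i j e (t + L) = D i j e t" for i j e t
  proof (induction j arbitrary: e t)
    case 0
    show ?case
    proof (induction i arbitrary: e t)
      case 0
      show ?case using G D00 by (simp add: admissible_variation_def)
    next
      case (Suc i)
      have "((\<lambda>e. D i 0 e t) has_vector_derivative D (Suc i) 0 e (t + L)) (at e)"
        using De[of i 0 "t + L" e] Suc by simp
      then show ?case using De vector_derivative_unique_at by blast
    qed
  next
    case (Suc j)
    show ?case using Suc has_vector_derivative_periodic[OF Dt] by blast
  qed
  have D0: "D 0 n 0 = g n" for n
  proof (induction n)
    case 0
    show ?case using G D00 by (simp add: admissible_variation_def)
  next
    case (Suc n)
    show ?case using Dt[of 0 n 0] g[of n] Suc vector_derivative_unique_at by (metis ext)
  qed
  have cD [continuous_intros]: "continuous_on A (\<lambda>x. D i j (p x) (q x))"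
    if "continuous_on A p" "continuous_on A q"
    for A :: "'x::topological_space set" and i j p q
    using continuous_on_compose2[OF cont continuous_on_Pair[OF that]] by auto
  define W where "W e t = det2 (D 0 1 e t) (D 0 2 e t)" for e t
  have W_per: "W e (t + L) = W e t" for e t by (simp add: W_def D_per)
  \<comment> \<open>A deformed curve may degenerate for large \<open>e\<close>. At
    \<open>e = 0\<close> the determinant \<open>W\<close> equals 1, and the tube lemma on the
    compact period gives one \<open>\<epsilon>\<close> for which \<open>W\<close> stays positive at
    all \<open>t\<close>.\<close>
  have "open ((\<lambda>p. W (snd p) (fst p)) -` {0<..})"
    unfolding W_def by (intro open_vimage continuous_intros)
  then have "openin (top_of_set ({0..L} \<times> UNIV))
      (({0..L} \<times> UNIV) \<inter> (\<lambda>p. W (snd p) (fst p)) -` {0<..})"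
    by (rule openin_open_Int)
  moreover have "(\<lambda>t. (t, 0)) ` {0..L} \<subseteq> ({0..L} \<times> UNIV) \<inter> (\<lambda>p. W (snd p) (fst p)) -` {0<..}"
    using arclength D0 by (auto simp: W_def)
  moreover have "{0..L} \<noteq> {}" using L by simp
  ultimately obtain N where "openin (top_of_set UNIV) N" and N: "0 \<in> N"
    "{0..L} \<times> N \<subseteq> ({0..L} \<times> UNIV) \<inter> (\<lambda>p. W (snd p) (fst p)) -` {0<..}"
    by - (rule tube_lemma[OF compact_Icc])
  then obtain \<epsilon> where \<epsilon>: "\<epsilon> > 0" "ball 0 \<epsilon> \<subseteq> N"
    using open_contains_ball[of N] by auto
  have Wpos: "W e t > 0" if "e \<in> ball 0 \<epsilon>" for e t
  proof -
    obtain s where "s \<in> {0..L}" "W e s = W e t"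
      using periodic_representative[of L "W e" t] L W_per by metis
    with that N \<epsilon> show ?thesis by fastforce
  qed
  define F where "F e t = curv_density (D 0 1 e t) (D 0 2 e t) (D 0 3 e t) (D 0 4 e t)
      - \<mu> * W e t powr (1/3)" for e t
  define F' where "F' e t =
      curv_density' (D 0 1 e t) (D 0 2 e t) (D 0 3 e t) (D 0 4 e t) (D 1 1 e t) (D 1 2 e t) (D 1 3 e t) (D 1 4 e t)
      - \<mu> * (1/3 * W e t powr (- (2/3)) * (det2 (D 1 1 e t) (D 0 2 e t) + det2 (D 0 1 e t) (D 1 2 e t)))"
    for e t
  have De0: "((\<lambda>e. D 0 j e t) has_vector_derivative D 1 j e t) (at e)" for j e t
    using De[of 0] by simp
  have F': "((\<lambda>e. F e t) has_real_derivative F' e t) (at e)" if "e \<in> ball 0 \<epsilon>" for e t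
    unfolding F_def F'_def W_def
    by (intro DERIV_diff DERIV_cmult has_real_derivative_curv_density has_real_derivative_speed De0)
      (use Wpos[OF that, of t] in \<open>auto simp: W_def\<close>)
  have cdens: "continuous_on {0..L} (\<lambda>t. curv_density (D 0 1 e t) (D 0 2 e t) (D 0 3 e t) (D 0 4 e t))"
    and cspeed: "continuous_on {0..L} (\<lambda>t. W e t powr (1/3))" if "e \<in> ball 0 \<epsilon>" for e
    unfolding curv_density_def W_def using Wpos[OF that]
    by (auto intro!: continuous_intros simp: W_def less_imp_neq[symmetric])
  have functional: "aff_total_curv (G e) L - \<mu> * aff_length (G e) L = integral {0..L} (F e)"
    if e: "e \<in> ball 0 \<epsilon>" for e
  proof -
    have d: "(G e has_vector_derivative D 0 1 e t) (at t)" "(D 0 1 e has_vector_derivative D 0 2 e t) (at t)"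
      "(D 0 2 e has_vector_derivative D 0 3 e t) (at t)" "(D 0 3 e has_vector_derivative D 0 4 e t) (at t)" for t
      using Dt[of 0 0 e t] Dt[of 0 1 e t] Dt[of 0 2 e t] Dt[of 0 3 e t] D00
      by (simp_all add: numeral_eq_Suc)
    note dens = aff_densities[OF d Wpos[OF e, unfolded W_def]]
    have "aff_total_curv (G e) L = integral {0..L} (\<lambda>t. curv_density (D 0 1 e t) (D 0 2 e t) (D 0 3 e t) (D 0 4 e t))"
      by (simp add: aff_total_curv_def dens(2))
    moreover have "aff_length (G e) L = integral {0..L} (\<lambda>t. W e t powr (1/3))"
      unfolding aff_length_def W_def by (intro integral_cong) (simp add: dens(1))
    ultimately show ?thesis
      unfolding F_def using cdens[OF e] cspeed[OF e]
      by (subst integral_diff) (auto intro!: integrable_continuous_interval continuous_intros)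
  qed
  have "((\<lambda>e. integral (cbox 0 L) (F e)) has_field_derivative integral (cbox 0 L) (F' 0)) (at 0 within ball 0 \<epsilon>)"
  proof (rule leibniz_rule_field_derivative)
    show "((\<lambda>e. F e t) has_field_derivative F' e t) (at e within ball 0 \<epsilon>)" if "e \<in> ball 0 \<epsilon>" for e t
      using F'[OF that] by (rule has_field_derivative_at_within)
    show "F e integrable_on cbox 0 L" if "e \<in> ball 0 \<epsilon>" for e
      unfolding F_def using cdens[OF that] cspeed[OF that]
      by (auto intro!: integrable_continuous_interval continuous_intros)
    show "continuous_on (ball 0 \<epsilon> \<times> cbox 0 L) (\<lambda>(e, t). F' e t)"
      unfolding F'_def curv_density'_def Let_def split_beta W_def using Wpos
      by (fastforce intro!: continuous_intros simp: W_def less_imp_neq[symmetric])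
  qed (use \<epsilon> in auto)
  then have "((\<lambda>e. integral {0..L} (F e)) has_real_derivative integral {0..L} (F' 0)) (at 0)"
    using \<epsilon> at_within_open[of "0::real" "ball 0 \<epsilon>"] by (simp add: cbox_interval)
  \<comment> \<open>The integral formula holds only for \<open>e\<close> in the ball, which suffices
    for the derivative at 0.\<close>
  then have der: "((\<lambda>e. aff_total_curv (G e) L - \<mu> * aff_length (G e) L) has_real_derivative
      integral {0..L} (F' 0)) (at 0)"
    by (rule has_field_derivative_transform_within_open[of _ _ _ "ball 0 \<epsilon>"]) (use \<epsilon> functional in auto)
  have F'0: "F' 0 = (\<lambda>t.
      curv_density' (g 1 t) (g 2 t) (g 3 t) (g 4 t) (D 1 1 0 t) (D 1 2 0 t) (D 1 3 0 t) (D 1 4 0 t)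
      - \<mu> * (1/3 * (det2 (D 1 1 0 t) (g 2 t) + det2 (g 1 t) (D 1 2 0 t))))"
    using arclength by (auto simp: F'_def W_def D0)
  have int: "integral {0..L} (F' 0) = integral {0..L} (\<lambda>t. 2/3 * EL \<mu> t * det2 (g 1 t) (D 1 0 0 t))"
    unfolding F'0 by (rule first_variation_integral[of "\<lambda>n. D 1 n 0" \<mu>, OF Dt D_per])
  show thesis
  proof (rule that)
    show "((\<lambda>e. G e t) has_vector_derivative D 1 0 e t) (at e)" for e t
      using De0[of 0] D00 by simp
  qed (use der in \<open>simp only: int\<close>)
qed

text \<open>The deformation is affine in \<open>e\<close>, so its partial derivatives of order two
  or more in \<open>e\<close> vanish; this gives the table \<open>D\<close>.\<close>

lemma admissible_linear_variation:
  assumes "smooth_curve V" "\<And>t. V (t + L) = V t"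
  shows "admissible_variation (g 0) L (\<lambda>e t. g 0 t + e *\<^sub>R V t)"
proof -
  obtain v where v: "v 0 = V" "\<And>n t. (v n has_vector_derivative v (Suc n) t) (at t)"
    using assms unfolding smooth_curve_def by metis
  define D where "D i j e t = (if i = 0 then g j t + e *\<^sub>R v j t else if i = 1 then v j t else 0)"
    for i j :: nat and e t :: real
  have cv: "continuous_on UNIV (v n)" for n
    using v by (meson continuous_at_imp_continuous_on has_vector_derivative_continuous)
  have "continuous_on UNIV (\<lambda>p. D i j (fst p) (snd p))" for i j
    unfolding D_def
    by (cases "i = 0"; cases "i = 1")
      (auto intro!: continuous_intros continuous_on_compose2[OF cv]
        continuous_on_compose2[OF continuous_on_g[of UNIV]])
  moreover have "((\<lambda>e. D i j e t) has_vector_derivative D (Suc i) j e t) (at e)" for i j e t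
    unfolding D_def by (auto intro!: derivative_eq_intros)
  moreover have "(D i j e has_vector_derivative D i (Suc j) e t) (at t)" for i j e t
    unfolding D_def[abs_def] by (auto intro!: derivative_eq_intros v g)
  moreover have "D 0 0 = (\<lambda>e t. g 0 t + e *\<^sub>R V t)"
    by (simp add: D_def fun_eq_iff v(1))
  ultimately have "smooth2 (\<lambda>e t. g 0 t + e *\<^sub>R V t)"
    unfolding smooth2_def by blast
  then show ?thesis
    using assms g_per by (simp add: admissible_variation_def)
qed

section \<open>The Euler-Lagrange equation and its solutions\<close>

lemma critical_iff_EL:
  "length_constrained_critical (g 0) L \<longleftrightarrow> (\<exists>\<mu>. \<forall>t. EL \<mu> t = 0)"
proof
  assume "length_constrained_critical (g 0) L"
  then obtain \<mu> where \<mu>: "\<forall>G. admissible_variation (g 0) L G \<longrightarrow>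
      ((\<lambda>e. aff_total_curv (G e) L - \<mu> * aff_length (G e) L) has_real_derivative 0) (at 0)"
    unfolding length_constrained_critical_def by (elim exE)
  \<comment> \<open>This choice replaces bump functions: since \<open>|g 1, g 2|\<close> = 1, the
    component \<open>|g 1, V|\<close> is \<open>EL \<mu>\<close> itself, and the first variation
    becomes 2/3 times the integral of its square.\<close>
  define V where "V t = EL \<mu> t *\<^sub>R g 2 t" for t
  define G where "G e t = g 0 t + e *\<^sub>R V t" for e t
  have "smooth_curve V"
    unfolding V_def by (intro smooth_curve_bilinear[OF bounded_bilinear_scaleR] smooth_EL smooth_g)
  then have G: "admissible_variation (g 0) L G"
    unfolding G_def by (rule admissible_linear_variation) (simp add: V_def periodic_\<kappa> periodic_g)
  obtain V' where V': "\<And>e t. ((\<lambda>e. G e t) has_vector_derivative V' e t) (at e)"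
    and der: "((\<lambda>e. aff_total_curv (G e) L - \<mu> * aff_length (G e) L) has_real_derivative
       integral {0..L} (\<lambda>t. 2/3 * EL \<mu> t * det2 (g 1 t) (V' 0 t))) (at 0)"
    by (rule first_variation[OF G, of \<mu>]) (rule that)
  have "((\<lambda>e. G e t) has_vector_derivative V t) (at 0)" for t
    unfolding G_def by (auto intro!: derivative_eq_intros)
  then have "V' 0 t = V t" for t
    using V' vector_derivative_unique_at by blast
  then have eq: "2/3 * EL \<mu> t * det2 (g 1 t) (V' 0 t) = 2/3 * (EL \<mu> t)\<^sup>2" for t
    using arclength[of t]
    by (simp add: V_def bounded_bilinear.scaleR_right[OF bounded_bilinear_det2] power2_eq_square)
  have "integral {0..L} (\<lambda>t. 2/3 * (EL \<mu> t)\<^sup>2) = 0"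
    using DERIV_unique[OF der \<mu>[rule_format, OF G]] by (simp only: eq)
  then have "integral {0..L} (\<lambda>t. (EL \<mu> t)\<^sup>2) = 0"
    by simp
  then have "EL \<mu> t = 0" for t
    using periodic_square_integral_zero[of L "EL \<mu>"] L periodic_\<kappa>(3) continuous_on_EL by blast
  then show "\<exists>\<mu>. \<forall>t. EL \<mu> t = 0" by blast
next
  assume "\<exists>\<mu>. \<forall>t. EL \<mu> t = 0"
  then obtain \<mu> where \<mu>: "\<And>t. EL \<mu> t = 0" by blast
  show "length_constrained_critical (g 0) L"
    unfolding length_constrained_critical_def
  proof (intro exI[of _ \<mu>] allI impI)
    fix G assume G: "admissible_variation (g 0) L G"
    show "((\<lambda>e. aff_total_curv (G e) L - \<mu> * aff_length (G e) L) has_real_derivative 0) (at 0)"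
      by (rule first_variation[OF G, of \<mu>]) (simp add: \<mu>)
  qed
qed

lemma EL_imp_constant:
  assumes EL: "\<And>t. EL \<mu> t = 0"
  shows "\<kappa> t = - \<mu>"
proof -
  have \<kappa>2: "\<kappa>2 t = - \<kappa> t * (\<kappa> t + \<mu>)" for t
    using EL[of t] by (simp add: EL_def algebra_simps power2_eq_square)
  \<comment> \<open>the constant vector with \<open>|\<gamma>', v| = \<kappa> + \<mu>\<close>\<close>
  define v where "v t = (\<kappa> t + \<mu>) *\<^sub>R g 2 t - \<kappa>1 t *\<^sub>R g 1 t" for t
  \<comment> \<open>The terms \<open>\<kappa>1 t *\<^sub>R g 2 t\<close> cancel, and the other two
    cancel because \<open>\<kappa> + \<mu>\<close> and \<open>g 1\<close> satisfy the same linear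
    second-order equation.\<close>
  have "(v has_vector_derivative 0) (at t)" for t
    unfolding v_def
    by (rule derivative_eq_intros refl \<kappa>_deriv \<kappa>1_deriv g_deriv)+ (simp add: g3 \<kappa>2 algebra_simps)
  then have "v t = v 0" for t
    using has_vector_derivative_zero_constant[of UNIV v] by (metis UNIV_I convex_UNIV)
  moreover have "\<kappa> t + \<mu> = det2 (g 1 t) (v t)" for t
    using arclength[of t] by (simp add: v_def det2_def algebra_simps)
  ultimately have w: "\<kappa> t + \<mu> = det2 (g 1 t) (v 0)" for t by metis
  \<comment> \<open>By the formula for \<open>\<kappa>2\<close>, the derivative of \<open>P\<close>
    is the square of \<open>\<kappa> + \<mu>\<close>. Closedness of the curve enters through
    \<open>g 0\<close> here: it makes \<open>P\<close> periodic, so that this square has integral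
    zero.\<close>
  define P where "P t = \<mu> * det2 (g 0 t) (v 0) - \<kappa>1 t" for t
  have "(P has_real_derivative \<mu> * (\<kappa> t + \<mu>) - \<kappa>2 t) (at t)" for t
    unfolding P_def w
    by (rule derivative_eq_intros g_deriv \<kappa>1_deriv refl)+ (simp add: det2_def)
  then have "((\<lambda>t. \<mu> * (\<kappa> t + \<mu>) - \<kappa>2 t) has_integral P L - P 0) {0..L}"
    using L by (intro fundamental_theorem_of_calculus)
      (auto simp: has_real_derivative_iff_has_vector_derivative[symmetric]
        intro: has_field_derivative_at_within)
  moreover have "P L = P 0"
    using periodic_g[of _ 0] periodic_\<kappa>[of 0] by (simp add: P_def)
  moreover have "\<mu> * (\<kappa> t + \<mu>) - \<kappa>2 t = (\<kappa> t + \<mu>)\<^sup>2" for t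
    by (simp add: \<kappa>2 algebra_simps power2_eq_square)
  ultimately have int: "integral {0..L} (\<lambda>t. (\<kappa> t + \<mu>)\<^sup>2) = 0"
    by (simp add: has_integral_iff)
  have cont: "continuous_on UNIV (\<lambda>t. \<kappa> t + \<mu>)"
    unfolding \<kappa>_eq by (intro continuous_intros)
  have "\<kappa> t + \<mu> = 0"
    by (rule periodic_square_integral_zero[where f = "\<lambda>t. \<kappa> t + \<mu>", OF L _ cont int])
      (simp add: periodic_\<kappa>(1))
  then show ?thesis by simp
qed

section \<open>Constant curvature and ellipses\<close>

lemma constant_imp_EL:
  assumes "\<And>t. \<kappa> t = k"
  shows "EL (- k) t = 0"
proof -
  have "\<kappa> = (\<lambda>t. k)" using assms by auto
  then have "\<kappa>1 t = 0" for t using \<kappa>_deriv[of t] DERIV_unique[OF _ DERIV_const] by metis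
  then have "\<kappa>1 = (\<lambda>t. 0)" by auto
  then have "\<kappa>2 t = 0" for t using \<kappa>1_deriv[of t] DERIV_unique[OF _ DERIV_const] by metis
  then show ?thesis by (simp add: EL_def assms power2_eq_square)
qed

text \<open>The derivative of the inner product of \<open>g 1\<close> and \<open>g 2\<close> is the
  squared norm of \<open>g 2\<close> minus \<open>k\<close> times that of \<open>g 1\<close>. For
  \<open>k\<close> not positive the product would increase strictly, contradicting
  periodicity.\<close>

lemma constant_pos:
  assumes "\<And>t. \<kappa> t = k"
  shows "k > 0"
proof (rule ccontr)
  assume k: "\<not> k > 0"
  have "((\<lambda>t. g 1 t \<bullet> g 2 t) has_real_derivative g 1 t \<bullet> g 3 t + g 2 t \<bullet> g 2 t) (at t)" for t
    using bounded_bilinear.has_vector_derivative[OF bounded_bilinear_inner g_deriv(2) g_deriv(3)]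
    by (simp add: has_real_derivative_iff_has_vector_derivative)
  moreover have "g 1 t \<bullet> g 3 t + g 2 t \<bullet> g 2 t > 0" for t
  proof -
    have "g 2 t \<noteq> 0" using arclength[of t] by (auto simp: det2_def)
    then have "g 2 t \<bullet> g 2 t > 0" by simp
    moreover have "g 1 t \<bullet> g 3 t = - k * (g 1 t \<bullet> g 1 t)" by (simp add: g3 assms)
    moreover have "k * (g 1 t \<bullet> g 1 t) \<le> 0" using k by (simp add: mult_nonpos_nonneg)
    ultimately show ?thesis by linarith
  qed
  ultimately have "g 1 0 \<bullet> g 2 0 < g 1 L \<bullet> g 2 L"
    by (intro DERIV_pos_imp_increasing[OF L]) blast
  then show False using periodic_g[of _ 0] by simp
qed

lemma constant_imp_ellipse:
  assumes \<kappa>: "\<And>t. \<kappa> t = k"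
  shows "is_ellipse (range (g 0))"
proof -
  define \<omega> where "\<omega> = sqrt k"
  have \<omega>: "\<omega> > 0" "\<omega> * \<omega> = k"
    using constant_pos[OF \<kappa>] by (auto simp: \<omega>_def)
  have const: "f t = f 0" if "\<And>t. (f has_vector_derivative 0) (at t)"
    for f :: "real \<Rightarrow> real \<times> real" and t
    using has_vector_derivative_zero_constant[of UNIV f] that by (metis UNIV_I convex_UNIV)
  \<comment> \<open>Three conserved quantities: \<open>A\<close> and \<open>B\<close> undo the
    rotation of the pair formed by \<open>g 1\<close> and \<open>g 2\<close> divided by
    \<open>\<omega>\<close>, and \<open>C\<close> is the centre of the ellipse. Solving them for
    \<open>g 0\<close> gives the parametrisation.\<close>
  define A where "A t = cos (\<omega> * t) *\<^sub>R g 1 t - (sin (\<omega> * t) / \<omega>) *\<^sub>R g 2 t" for t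
  define B where "B t = sin (\<omega> * t) *\<^sub>R g 1 t + (cos (\<omega> * t) / \<omega>) *\<^sub>R g 2 t" for t
  define C where "C t = g 0 t + (1 / k) *\<^sub>R g 2 t" for t
  have "(A has_vector_derivative 0) (at t)" for t
    unfolding A_def using \<omega>
    by (auto intro!: derivative_eq_intros simp: g3 \<kappa> \<omega>(2)[symmetric] algebra_simps)
  moreover have "(B has_vector_derivative 0) (at t)" for t
    unfolding B_def using \<omega>
    by (auto intro!: derivative_eq_intros simp: g3 \<kappa> \<omega>(2)[symmetric] algebra_simps)
  moreover have "(C has_vector_derivative 0) (at t)" for t
    unfolding C_def using constant_pos[OF \<kappa>]
    by (auto intro!: derivative_eq_intros simp: g3 \<kappa>)
  ultimately have ABC: "A t = A 0" "B t = B 0" "C t = C 0" for t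
    using const by blast+
  have "g 2 t = \<omega> *\<^sub>R (cos (\<omega> * t) *\<^sub>R B t - sin (\<omega> * t) *\<^sub>R A t)" for t
  proof -
    have "(cos (\<omega> * t) * cos (\<omega> * t)) *\<^sub>R g 2 t + (sin (\<omega> * t) * sin (\<omega> * t)) *\<^sub>R g 2 t = g 2 t"
      by (simp add: scaleR_add_left[symmetric] power2_eq_square[symmetric])
    then show ?thesis using \<omega> by (simp add: A_def B_def algebra_simps)
  qed
  moreover have "A t = g 1 0" "B t = (1 / \<omega>) *\<^sub>R g 2 0" for t
    unfolding ABC[of t] by (simp_all add: A_def B_def)
  ultimately have g2: "g 2 t = \<omega> *\<^sub>R (cos (\<omega> * t) *\<^sub>R (1 / \<omega>) *\<^sub>R g 2 0 - sin (\<omega> * t) *\<^sub>R g 1 0)" for t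
    by metis
  have g0: "g 0 t = C 0 - (1 / k) *\<^sub>R g 2 t" for t
    using ABC(3)[of t] by (simp add: C_def eq_diff_eq)
  define f where "f \<theta> = (fst (C 0) + (- fst (g 2 0) / k) * cos \<theta> + fst (g 1 0) / \<omega> * sin \<theta>,
      snd (C 0) + (- snd (g 2 0) / k) * cos \<theta> + snd (g 1 0) / \<omega> * sin \<theta>)" for \<theta>
  have param: "g 0 t = f (\<omega> * t)" for t
    unfolding g0 g2[of t] f_def using \<omega>
    by (auto simp: prod_eq_iff \<omega>(2)[symmetric] field_simps)
  \<comment> \<open>The angle \<open>\<omega> * t\<close> takes every real value, so the curve
    covers the whole ellipse.\<close>
  moreover have "f \<theta> = g 0 (\<theta> / \<omega>)" for \<theta> using \<omega> by (simp add: param)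
  ultimately have "range (g 0) = {f \<theta> | \<theta>. True}" by blast
  moreover have "(- fst (g 2 0) / k) * (snd (g 1 0) / \<omega>) - fst (g 1 0) / \<omega> * (- snd (g 2 0) / k) = 1 / (k * \<omega>)"
    using arclength[of 0] \<omega> constant_pos[OF \<kappa>] by (simp add: det2_def field_simps)
  then have "(- fst (g 2 0) / k) * (snd (g 1 0) / \<omega>) - fst (g 1 0) / \<omega> * (- snd (g 2 0) / k) \<noteq> 0"
    using \<omega> constant_pos[OF \<kappa>] by simp
  ultimately show ?thesis
    unfolding is_ellipse_def f_def by blast
qed

text \<open>In coordinates \<open>p\<close> that make the ellipse a unit circle, \<open>p' = \<lambda> J p\<close> with the rotation \<open>J\<close>
  by a right angle, so \<open>|p', p''| = \<lambda>\<^sup>3\<close>; the arc-length condition makes \<open>\<lambda>\<close> constant.\<close>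
lemma ellipse_imp_constant:
  assumes "is_ellipse (range (g 0))"
  obtains k where "\<And>t. \<kappa> t = k"
proof -
  obtain c1 c2 a b d e where \<Delta>: "a * e - b * d \<noteq> 0"
    and E: "range (g 0) = {(c1 + a * cos \<theta> + b * sin \<theta>, c2 + d * cos \<theta> + e * sin \<theta>) | \<theta>. True}"
    using assms unfolding is_ellipse_def by blast
  define \<Delta> where "\<Delta> = a * e - b * d"
  \<comment> \<open>\<open>X\<close> and \<open>Y\<close> are the components of the inverse of the
    matrix with rows (a, b) and (d, e), which takes the centred ellipse to the unit circle.\<close>
  define X where "X u = (e * fst u - b * snd u) / \<Delta>" for u :: "real \<times> real"
  define Y where "Y u = (a * snd u - d * fst u) / \<Delta>" for u :: "real \<times> real"
  define p q where "p t = X (g 0 t - (c1, c2))" and "q t = Y (g 0 t - (c1, c2))" for t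
  have \<Delta>0: "\<Delta> \<noteq> 0" using \<Delta> by (simp add: \<Delta>_def)
  have circle: "p t * p t + q t * q t = 1" for t
  proof -
    obtain \<theta> where \<theta>: "g 0 t = (c1 + a * cos \<theta> + b * sin \<theta>, c2 + d * cos \<theta> + e * sin \<theta>)"
      using E by blast
    have "e * (a * cos \<theta> + b * sin \<theta>) - b * (d * cos \<theta> + e * sin \<theta>) = \<Delta> * cos \<theta>"
      "a * (d * cos \<theta> + e * sin \<theta>) - d * (a * cos \<theta> + b * sin \<theta>) = \<Delta> * sin \<theta>"
      by (simp_all add: \<Delta>_def algebra_simps)
    then have "p t = cos \<theta>" "q t = sin \<theta>"
      using \<Delta>0 by (simp_all add: p_def q_def X_def Y_def \<theta> add.assoc)
    then show ?thesis by (simp add: power2_eq_square[symmetric])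
  qed
  have "bounded_linear X" "bounded_linear Y"
    unfolding X_def Y_def
    by (auto intro!: bounded_linear_intros simp: divide_inverse)
  then have d: "((\<lambda>t. X (f t)) has_real_derivative X f') (at t)"
    "((\<lambda>t. Y (f t)) has_real_derivative Y f') (at t)"
    if "(f has_vector_derivative f') (at t)" for f f' t
    using bounded_linear.has_vector_derivative[OF _ that]
    by (auto simp: has_real_derivative_iff_has_vector_derivative)
  have "((\<lambda>t. g 0 t - (c1, c2)) has_vector_derivative g 1 t) (at t)" for t
    by (auto intro!: derivative_eq_intros)
  from d[OF this] have p1: "(p has_real_derivative X (g 1 t)) (at t)"
    and q1: "(q has_real_derivative Y (g 1 t)) (at t)" for t
    by (simp_all add: p_def[abs_def] q_def[abs_def])
  have orth: "p t * X (g 1 t) + q t * Y (g 1 t) = 0" for t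
  proof -
    have "((\<lambda>t. p t * p t + q t * q t) has_real_derivative 2 * (p t * X (g 1 t) + q t * Y (g 1 t))) (at t)"
      by (rule derivative_eq_intros p1 q1 refl)+ (simp add: algebra_simps)
    then have "((\<lambda>t. 1) has_real_derivative 2 * (p t * X (g 1 t) + q t * Y (g 1 t))) (at t)"
      by (simp only: circle)
    from DERIV_unique[OF this DERIV_const] show ?thesis by simp
  qed
  \<comment> \<open>\<open>l\<close> is the angular speed on the circle. Since the velocity is
    orthogonal to the position (p, q), it equals \<open>l\<close> times the position turned by a
    right angle.\<close>
  define l where "l t = p t * Y (g 1 t) - q t * X (g 1 t)" for t
  have X1: "X (g 1 t) = - l t * q t" and Y1: "Y (g 1 t) = l t * p t" for t
    using circle[of t] orth[of t] unfolding l_def by algebra+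
  have l1: "(l has_real_derivative p t * Y (g 2 t) - q t * X (g 2 t)) (at t)" for t
    unfolding l_def by (rule derivative_eq_intros p1 q1 d g_deriv refl)+ simp
  \<comment> \<open>Differentiating the velocity splits the acceleration into a tangential part with
    coefficient \<open>l'\<close>, written out as \<open>p t * Y (g 2 t) - q t * X (g 2 t)\<close>,
    and a radial part with coefficient \<open>- l\<^sup>2\<close>.\<close>
  have XY2: "X (g 2 t) = - (p t * Y (g 2 t) - q t * X (g 2 t)) * q t - l t * (l t * p t)" 
    "Y (g 2 t) = (p t * Y (g 2 t) - q t * X (g 2 t)) * p t + l t * (- l t * q t)" for t
  proof -
    have "((\<lambda>t. X (g 1 t)) has_real_derivative - (p t * Y (g 2 t) - q t * X (g 2 t)) * q t - l t * (l t * p t)) (at t)"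
      unfolding X1 by (rule derivative_eq_intros p1 q1 l1 refl)+ (simp add: Y1[unfolded One_nat_def])
    then show "X (g 2 t) = - (p t * Y (g 2 t) - q t * X (g 2 t)) * q t - l t * (l t * p t)"
      using DERIV_unique d(1)[OF g_deriv(2)] by blast
    have "((\<lambda>t. Y (g 1 t)) has_real_derivative (p t * Y (g 2 t) - q t * X (g 2 t)) * p t + l t * (- l t * q t)) (at t)"
      unfolding Y1 by (rule derivative_eq_intros p1 q1 l1 refl)+ (simp add: X1[unfolded One_nat_def])
    then show "Y (g 2 t) = (p t * Y (g 2 t) - q t * X (g 2 t)) * p t + l t * (- l t * q t)"
      using DERIV_unique d(2)[OF g_deriv(2)] by blast
  qed
  have det: "X u * Y v - Y u * X v = det2 u v / \<Delta>" for u v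
    using \<Delta>0 unfolding X_def Y_def det2_def
    by (simp add: field_simps) (simp add: \<Delta>_def algebra_simps)
  have cube: "l t ^ 3 = 1 / \<Delta>" for t
  proof -
    have "l t ^ 3 = X (g 1 t) * Y (g 2 t) - Y (g 1 t) * X (g 2 t)"
      using circle[of t] XY2[of t] X1[of t] Y1[of t] by algebra
    then show ?thesis using det arclength by simp
  qed
  \<comment> \<open>A real number is determined by its cube.\<close>
  then have "l t = l 0" for t
    by (metis odd_real_root_power_cancel odd_numeral)
  then have l: "l = (\<lambda>t. l 0)" by auto
  then have "p t * Y (g 2 t) - q t * X (g 2 t) = 0" for t
    using l1[of t] DERIV_unique[OF _ DERIV_const] by metis
  then have X2: "X (g 2 t) = - (l 0)\<^sup>2 * p t" and Y2: "Y (g 2 t) = - (l 0)\<^sup>2 * q t" for t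
    using XY2[of t] l by (simp_all add: power2_eq_square) metis+
  have X3: "X (g 3 t) = - (l 0)\<^sup>2 * X (g 1 t)" and Y3: "Y (g 3 t) = - (l 0)\<^sup>2 * Y (g 1 t)" for t
  proof -
    have "((\<lambda>t. X (g 2 t)) has_real_derivative - (l 0)\<^sup>2 * X (g 1 t)) (at t)"
      "((\<lambda>t. Y (g 2 t)) has_real_derivative - (l 0)\<^sup>2 * Y (g 1 t)) (at t)"
      unfolding X2 Y2 by (rule DERIV_cmult p1 q1)+
    then show "X (g 3 t) = - (l 0)\<^sup>2 * X (g 1 t)" "Y (g 3 t) = - (l 0)\<^sup>2 * Y (g 1 t)"
      using DERIV_unique d[OF g_deriv(3)] by blast+
  qed
  \<comment> \<open>Both \<open>\<kappa>\<close> and the arc-length condition are determinants,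
    which the coordinates (X, Y) rescale by the common factor 1 / \<open>\<Delta>\<close>.\<close>
  have "\<kappa> t = (l 0)\<^sup>2" for t
  proof -
    have "\<kappa> t / \<Delta> = X (g 2 t) * Y (g 3 t) - Y (g 2 t) * X (g 3 t)"
      by (simp add: det \<kappa>_eq)
    also have "\<dots> = (l 0)\<^sup>2 * (X (g 1 t) * Y (g 2 t) - Y (g 1 t) * X (g 2 t))"
      by (simp add: X3 Y3 algebra_simps)
    also have "\<dots> = (l 0)\<^sup>2 / \<Delta>"
      using arclength[of t] by (simp add: det)
    finally show ?thesis using \<Delta>0 by simp
  qed
  then show thesis by (rule that)
qed

end

theorem theorem5:
  fixes \<gamma> :: "real \<Rightarrow> real \<times> real" and \<kappa> :: "real \<Rightarrow> real" and L :: real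
  assumes "smooth_curve \<gamma>"
    and "L > 0"
    and "\<forall>t. \<gamma> (t + L) = \<gamma> t"
    and "\<forall>t. det2 (vd \<gamma> t) (vd (vd \<gamma>) t) = 1"
    and "\<forall>t. vd (vd (vd \<gamma>)) t = - (\<kappa> t *\<^sub>R vd \<gamma> t)"
  shows "length_constrained_critical \<gamma> L \<longleftrightarrow> is_ellipse (range \<gamma>)"
proof -
  \<comment> \<open>The derivatives witnessing smoothness serve as the sequence \<open>g\<close> of
    the locale, and uniqueness of derivatives identifies them with the iterates of
    \<open>vd\<close>.\<close>
  obtain g where g_def: "g 0 = \<gamma>" "\<And>n t. (g n has_vector_derivative g (Suc n) t) (at t)"
    using assms(1) unfolding smooth_curve_def by blast
  have "vd (g n) = g (Suc n)" for n
    using g_def(2) by (rule vd_eqI)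
  then have "vd \<gamma> = g 1" "vd (vd \<gamma>) = g 2" "vd (vd (vd \<gamma>)) = g 3"
    using g_def(1) by (auto simp: numeral_eq_Suc)
  then interpret affine_arclength_curve g \<kappa> L
    using assms g_def by unfold_locales auto
  have "(\<exists>\<mu>. \<forall>t. EL \<mu> t = 0) \<longleftrightarrow> is_ellipse (range (g 0))"
    using EL_imp_constant constant_imp_ellipse ellipse_imp_constant constant_imp_EL by metis
  then show ?thesis
    using critical_iff_EL g_def(1) by simp
qed

end
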